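(* Let $(u_n)$ be a sequence of functions of bounded variation on the bounded real interval $[a,b]$. If there is a constant $M$ so that $\operatorname{TV}(u_n)\le M$ and $\|u_n\|_\infty\le M$ for all $n$, then there is a subsequence of $(u_n)$ which converges pointwise everywhere and in $L^1$ norm in $[a,b]$ to a function of bounded variation.
   Context: Functions are real-valued. An integrable function $f$ is of bounded variation if it has finite essential (total) variation, that is, if $\operatorname{TV}(f)=\sup\sum_{j=1}^{m}|f(x_{j+1})-f(x_j)|<\infty$, where the supremum is taken over all finite partitions $x_1<x_2<\dots<x_{m+1}$ (with points in the domain, here $[a,b]$) such that each $x_j$ is a point of approximate continuity of $f$. A point $x_j$ is a point of approximate continuity of $f$ if, for every $\epsilon>0$, $\delta^{-1}\,|\{x : |x-x_j|<\delta,\ |f(x)-f(x_j)|\ge\epsilon\}|\to 0$ as $\delta\to0$, where $x$ ranges over the domain of $f$ and $|\cdot|$ applied to a set denotes Lebesgue measure. $\|\cdot\|_\infty$ is the $L^\infty$ norm on $[a,b]$.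
   Formalization: Taken with a<b; as TV and the sup norm ignore null sets, u_n=n at one point, 0 elsewhere, refutes the literal claim; pointwise convergence is proved for any representatives (equal a.e. to u_n) whose variation over all partitions equals TV(u_n); L^1 convergence is for u_n itself. *)

theory Defs
  imports "HOL-Analysis.Analysis" "HOL-Probability.Essential_Supremum"
begin

text \<open>
  All notions below concern the restriction of a function to the interval \<open>{a..b}\<close>;
  its values outside the interval play no role.
\<close>

definition variation_over :: "real set \<Rightarrow> (real \<Rightarrow> real) \<Rightarrow> ereal" where
  "variation_over S f =
     (SUP (m, x) \<in> {(m :: nat, x :: nat \<Rightarrow> real). strict_mono_on {..m} x \<and> x ` {..m} \<subseteq> S}.
        ereal (\<Sum>j<m. \<bar>f (x (Suc j)) - f (x j)\<bar>))"

definition approx_continuous_at :: "real \<Rightarrow> real \<Rightarrow> (real \<Rightarrow> real) \<Rightarrow> real \<Rightarrow> bool" where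
  "approx_continuous_at a b f t \<longleftrightarrow>
     (\<forall>\<epsilon>>0. ((\<lambda>\<delta>. measure lebesgue {x \<in> {a..b}. \<bar>x - t\<bar> < \<delta> \<and> \<bar>f x - f t\<bar> \<ge> \<epsilon>} / \<delta>)
               \<longlongrightarrow> 0) (at_right 0))"

definition TV :: "real \<Rightarrow> real \<Rightarrow> (real \<Rightarrow> real) \<Rightarrow> ereal" where
  "TV a b f = variation_over {t \<in> {a..b}. approx_continuous_at a b f t} f"

definition bounded_variation :: "real \<Rightarrow> real \<Rightarrow> (real \<Rightarrow> real) \<Rightarrow> bool" where
  "bounded_variation a b f \<longleftrightarrow> integrable (lebesgue_on {a..b}) f \<and> TV a b f < \<infinity>"

definition Linf_norm :: "real \<Rightarrow> real \<Rightarrow> (real \<Rightarrow> real) \<Rightarrow> ereal" where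
  "Linf_norm a b f = esssup (lebesgue_on {a..b}) (\<lambda>x. ereal \<bar>f x\<bar>)"

text \<open>
  Integrability, \<open>TV\<close>, finiteness of \<open>TV\<close> and \<open>Linf_norm\<close> impose nothing on the values
  of a function on a null set: on \<open>{-1..1}\<close> the functions equal to \<open>n\<close> at \<open>0\<close> and to \<open>0\<close>
  elsewhere have \<open>TV = 0\<close> and \<open>Linf_norm = 0\<close>, yet no subsequence converges at \<open>0\<close>.
  Pointwise statements about functions of essentially bounded variation therefore refer to
  good representatives: functions in the same almost-everywhere class
  whose variation over all partitions of the interval equals the essential variation.
\<close>

definition good_representative ::
    "real \<Rightarrow> real \<Rightarrow> (real \<Rightarrow> real) \<Rightarrow> (real \<Rightarrow> real) \<Rightarrow> bool" where
  "good_representative a b f g \<longleftrightarrow>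
     (AE x in lebesgue_on {a..b}. g x = f x) \<and> variation_over {a..b} g = TV a b f"

end

theory Submission
  imports Defs "HOL-Complex_Analysis.Great_Picard"
begin

text \<open>
  By Lebesgue's density theorem a measurable function is approximately continuous almost
  everywhere, so the set \<open>A\<close> of its points of approximate continuity is dense in the interval.
  Extending \<open>f\<close> from \<open>A\<close> to \<open>{a..b}\<close> by limit points of its graph does not increase the variation,
  which yields a good representative. For a sequence of good representatives, which are uniformly
  bounded, Helly's selection argument applies: pass to a subsequence along which the variation
  functions over \<open>{a..t}\<close> converge for \<open>t\<close> in a countable dense set to a monotone limit, then to a
  further one along which the functions themselves converge on that set and on the countably many
  discontinuities of the limit. At any other point the oscillation is controlled by the increment
  of the variation functions, so the values form a Cauchy sequence. Dominated convergence gives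
  convergence in \<open>L\<^sup>1\<close>.
\<close>

section \<open>Lebesgue density on the line and approximate continuity\<close>

text \<open>A Vitali covering argument: each selected ball lies in an open \<open>U\<close>
  containing \<open>E\<close> and has more than \<open>c\<close> times its radius outside
  \<open>E\<close>. The balls are disjoint and these parts all lie in \<open>U - E\<close>, so the
  total length of the balls is at most \<open>2 / c\<close> times the measure of
  \<open>U - E\<close>, which is as small as desired.\<close>

lemma negligible_low_density_points:
  fixes E :: "real set" and c :: real
  assumes E: "E \<in> sets lebesgue" and c: "c > 0"
  shows "negligible {t \<in> E. \<forall>d>0. \<exists>\<delta>. 0 < \<delta> \<and> \<delta> < d \<and> c * \<delta> < measure lebesgue (ball t \<delta> - E)}"
    (is "negligible ?A")
  unfolding negligible_outer_le
proof (intro allI impI)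
  fix e :: real assume e: "e > 0"
  \<comment> \<open>The margin \<open>e * c / 2\<close> is chosen to cancel the factor
    \<open>2 / c\<close> that relates the length of a ball to its part outside
    \<open>E\<close>.\<close>
  obtain U where U: "open U" "E \<subseteq> U" "U - E \<in> lmeasurable"
      and mU: "emeasure lebesgue (U - E) < ennreal (e * c / 2)"
    using sets_lebesgue_outer_open[OF E, of "e * c / 2"] e c by auto
  have mU': "measure lebesgue (U - E) \<le> e * c / 2"
    using mU U(3) e c by (simp add: emeasure_eq_measure2 ennreal_less_iff)
  define K where "K = {(t, \<delta>). 0 < \<delta> \<and> ball t \<delta> \<subseteq> U \<and> c * \<delta> < measure lebesgue (ball t \<delta> - E)}"
  have "\<exists>i. i \<in> K \<and> x \<in> ball (fst i) (snd i) \<and> snd i < d" if x: "x \<in> ?A" and d: "0 < d" for x d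
  proof -
    have "x \<in> U" using x U(2) by auto
    then obtain k where k: "k > 0" "ball x k \<subseteq> U" using U(1) by (meson open_contains_ball)
    have "\<forall>d>0. \<exists>\<delta>. 0 < \<delta> \<and> \<delta> < d \<and> c * \<delta> < measure lebesgue (ball x \<delta> - E)"
      using x by simp
    moreover have "min d k > 0" using d k by simp
    ultimately obtain \<delta> where \<delta>: "0 < \<delta>" "\<delta> < min d k" "c * \<delta> < measure lebesgue (ball x \<delta> - E)"
      by blast
    have "ball x \<delta> \<subseteq> ball x k" using \<delta> by (intro subset_ball) auto
    then have "ball x \<delta> \<subseteq> U" using k(2) by (rule order_trans)
    then have "(x, \<delta>) \<in> K" using \<delta> by (simp add: K_def)
    then show ?thesis using \<delta> by force
  qed
  from Vitali_covering_theorem_balls[OF this]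
  obtain C where C: "countable C" "C \<subseteq> K"
     "pairwise (\<lambda>i j. disjnt (ball (fst i) (snd i)) (ball (fst j) (snd j))) C"
     "negligible (?A - (\<Union>i \<in> C. ball (fst i) (snd i)))"
    by blast
  let ?B = "\<lambda>i::real\<times>real. ball (fst i) (snd i)"
  \<comment> \<open>A bound uniform over finite subfamilies passes to the union over the countable
    family \<open>C\<close>.\<close>
  have fin: "measure lebesgue (\<Union>i\<in>I. ?B i) \<le> e" if I: "I \<subseteq> C" "finite I" for I
  proof -
    have IK: "I \<subseteq> K" using I C by auto
    have lm: "?B i - E \<in> lmeasurable" for i
      by (rule fmeasurable_Diff[OF lmeasurable_ball E])
    have "measure lebesgue (\<Union>i\<in>I. ?B i) \<le> (\<Sum>i\<in>I. measure lebesgue (?B i))"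
      using I by (intro measure_UNION_le) auto
    also have "\<dots> \<le> (\<Sum>i\<in>I. 2 / c * measure lebesgue (?B i - E))"
    proof (rule sum_mono)
      fix i assume "i \<in> I"
      then have "0 < snd i" "c * snd i < measure lebesgue (?B i - E)" using IK by (auto simp: K_def)
      then show "measure lebesgue (?B i) \<le> 2 / c * measure lebesgue (?B i - E)"
        using c by (simp add: ball_eq_greaterThanLessThan field_simps)
    qed
    also have "\<dots> = 2 / c * (\<Sum>i\<in>I. measure lebesgue (?B i - E))"
      by (simp add: sum_distrib_left)
    also have "(\<Sum>i\<in>I. measure lebesgue (?B i - E)) = measure lebesgue (\<Union>i\<in>I. ?B i - E)"
    proof (rule measure_UNION'[symmetric])
      show "pairwise (\<lambda>i j. disjnt (?B i - E) (?B j - E)) I"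
        using C(3) I(1) unfolding pairwise_def disjnt_def by blast
    qed (use I lm in auto)
    also have "2 / c * \<dots> \<le> 2 / c * measure lebesgue (U - E)"
    proof (rule mult_left_mono)
      show "measure lebesgue (\<Union>i\<in>I. ?B i - E) \<le> measure lebesgue (U - E)"
      proof (rule measure_mono_fmeasurable[OF _ _ U(3)])
        show "(\<Union>i\<in>I. ?B i - E) \<subseteq> U - E" using IK unfolding K_def by fastforce
        show "(\<Union>i\<in>I. ?B i - E) \<in> sets lebesgue" by (rule sets.finite_UN[OF I(2) fmeasurableD[OF lm]])
      qed
    qed (use c in simp)
    also have "2 / c * measure lebesgue (U - E) \<le> 2 / c * (e * c / 2)"
      using mU' c by (intro mult_left_mono) auto
    also have "\<dots> = e" using c by simp
    finally show ?thesis .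
  qed
  have B: "(\<Union>i\<in>C. ?B i) \<in> lmeasurable" "measure lebesgue (\<Union>i\<in>C. ?B i) \<le> e"
    by (rule fmeasurable_UN_bound[OF C(1) _ fin]; simp)
       (rule measure_UN_bound[OF C(1) _ fin]; simp)
  show "\<exists>T. ?A \<subseteq> T \<and> T \<in> lmeasurable \<and> measure lebesgue T \<le> e"
  proof (intro exI conjI)
    \<comment> \<open>The Vitali family misses a null part of the exceptional set; adding it back
      does not change the measure.\<close>
    let ?T = "(\<Union>i\<in>C. ?B i) \<union> (?A - (\<Union>i\<in>C. ?B i))"
    show "?A \<subseteq> ?T" by blast
    show "?T \<in> lmeasurable"
      using B C(4) negligible_imp_measurable by blast
    show "measure lebesgue ?T \<le> e"
      using B(2) measure_Un_null_set[OF fmeasurableD[OF B(1)] C(4)[unfolded negligible_iff_null_sets]]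
      by (simp only:)
  qed
qed

text \<open>Where the limit fails, the quotient is at least some \<open>c > 0\<close> at arbitrarily
  small scales, hence exceeds \<open>inverse (real (Suc n))\<close> for some \<open>n\<close>. This
  leaves a countable union of null sets.\<close>

lemma lebesgue_density_negligible:
  fixes E :: "real set"
  assumes E: "E \<in> sets lebesgue"
  shows "negligible {t \<in> E. \<not> ((\<lambda>\<delta>. measure lebesgue (ball t \<delta> - E) / \<delta>) \<longlongrightarrow> 0) (at_right 0)}"
proof -
  let ?A = "\<lambda>c. {t \<in> E. \<forall>d>0. \<exists>\<delta>. 0 < \<delta> \<and> \<delta> < d \<and> c * \<delta> < measure lebesgue (ball t \<delta> - E)}"
  have "negligible (\<Union>n. ?A (inverse (real (Suc n))))"
    by (intro negligible_countable_Union countable_image)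
      (auto intro!: negligible_low_density_points[OF E])
  moreover have "t \<in> (\<Union>n. ?A (inverse (real (Suc n))))"
    if t: "t \<in> E" and nt: "\<not> ((\<lambda>\<delta>. measure lebesgue (ball t \<delta> - E) / \<delta>) \<longlongrightarrow> 0) (at_right 0)" for t
  proof -
    obtain c where c: "c > 0"
      and nev: "\<not> (\<forall>\<^sub>F \<delta> in at_right 0. \<bar>measure lebesgue (ball t \<delta> - E) / \<delta>\<bar> < c)"
      using nt by (auto simp: tendsto_iff)
    obtain n where n: "inverse (real (Suc n)) < c" using reals_Archimedean[OF c] by blast
    have "\<exists>\<delta>. 0 < \<delta> \<and> \<delta> < d \<and> inverse (real (Suc n)) * \<delta> < measure lebesgue (ball t \<delta> - E)"
      if d: "d > 0" for d
    proof -
      obtain \<delta> where \<delta>: "0 < \<delta>" "\<delta> < d" "\<not> \<bar>measure lebesgue (ball t \<delta> - E) / \<delta>\<bar> < c"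
        using nev d unfolding eventually_at_right_field by blast
      then have "c * \<delta> \<le> measure lebesgue (ball t \<delta> - E)" by (simp add: field_simps)
      moreover have "inverse (real (Suc n)) * \<delta> < c * \<delta>"
        using n \<delta> by (intro mult_strict_right_mono)
      ultimately show ?thesis using \<delta> by (intro exI[of _ \<delta>]) linarith
    qed
    then show ?thesis using t by blast
  qed
  ultimately show ?thesis by (elim negligible_subset) blast
qed

text \<open>The density theorem is applied to the sets \<open>f > q\<close> and \<open>f < q\<close>
  for all rational \<open>q\<close>. Off the countable union of exceptional sets, \<open>f t\<close>
  can be enclosed between rationals whose super- and sublevel sets both have density one at
  \<open>t\<close>.\<close>

lemma negligible_not_approx_continuous_at:
  assumes f: "f \<in> borel_measurable (lebesgue_on {a..b})"
  shows "negligible {t \<in> {a..b}. \<not> approx_continuous_at a b f t}"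
proof -
  let ?E = "\<lambda>S. {x \<in> {a..b}. f x \<in> S}"
  define bad where "bad S = {t \<in> ?E S. \<not> ((\<lambda>\<delta>. measure lebesgue (ball t \<delta> - ?E S) / \<delta>) \<longlongrightarrow> 0) (at_right 0)}" for S
  have E: "?E S \<in> sets lebesgue" if "S \<in> sets borel" for S
  proof -
    have "f -` S \<inter> space (lebesgue_on {a..b}) \<in> sets (lebesgue_on {a..b})"
      using f that by (rule measurable_sets)
    moreover have "f -` S \<inter> space (lebesgue_on {a..b}) = ?E S" by auto
    ultimately show ?thesis by (simp add: sets_restrict_space_iff)
  qed
  have neg: "negligible (\<Union>q\<in>\<rat>. bad {q<..} \<union> bad {..<q})"
  proof (intro negligible_countable_Union countable_image countable_rat)
    have "negligible (bad S)" if "S \<in> sets borel" for S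
      unfolding bad_def by (rule lebesgue_density_negligible[OF E[OF that]])
    then show "negligible X" if "X \<in> (\<lambda>q. bad {q<..} \<union> bad {..<q}) ` \<rat>" for X
      using that by auto
  qed
  have "approx_continuous_at a b f t" if t: "t \<in> {a..b}" and nb: "t \<notin> (\<Union>q\<in>\<rat>. bad {q<..} \<union> bad {..<q})" for t
    unfolding approx_continuous_at_def
  proof (intro allI impI)
    fix \<epsilon> :: real assume "\<epsilon> > 0"
    obtain p where p: "p \<in> \<rat>" "f t - \<epsilon> < p" "p < f t"
      using Rats_dense_in_real[of "f t - \<epsilon>" "f t"] \<open>\<epsilon> > 0\<close> by auto
    obtain q where q: "q \<in> \<rat>" "f t < q" "q < f t + \<epsilon>"
      using Rats_dense_in_real[of "f t" "f t + \<epsilon>"] \<open>\<epsilon> > 0\<close> by auto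
    let ?P = "\<lambda>\<delta>. ball t \<delta> - ?E {p<..}" and ?Q = "\<lambda>\<delta>. ball t \<delta> - ?E {..<q}"
    let ?X = "\<lambda>\<delta>. {x \<in> {a..b}. \<bar>x - t\<bar> < \<delta> \<and> \<epsilon> \<le> \<bar>f x - f t\<bar>}"
    have "t \<notin> bad {p<..}" "t \<notin> bad {..<q}" using nb p q by auto
    moreover have "t \<in> ?E {p<..}" "t \<in> ?E {..<q}" using t p q by auto
    ultimately have "((\<lambda>\<delta>. measure lebesgue (?P \<delta>) / \<delta>) \<longlongrightarrow> 0) (at_right 0)"
        "((\<lambda>\<delta>. measure lebesgue (?Q \<delta>) / \<delta>) \<longlongrightarrow> 0) (at_right 0)"
      unfolding bad_def by blast+
    then have "((\<lambda>\<delta>. measure lebesgue (?P \<delta>) / \<delta> + measure lebesgue (?Q \<delta>) / \<delta>) \<longlongrightarrow> 0 + 0) (at_right 0)"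
      by (rule tendsto_add)
    moreover have "measure lebesgue (?X \<delta>) \<le> measure lebesgue (?P \<delta>) + measure lebesgue (?Q \<delta>)" for \<delta>
    proof -
      have lm: "?P \<delta> \<in> lmeasurable" "?Q \<delta> \<in> lmeasurable"
        by (rule fmeasurable_Diff[OF lmeasurable_ball E], simp)+
      have "?X \<delta> = ball t \<delta> \<inter> ?E {y. \<epsilon> \<le> \<bar>y - f t\<bar>}" by (auto simp: dist_real_def)
      also have "\<dots> \<in> sets lebesgue"
        by (intro sets.Int E) (auto intro!: borel_closed closed_Collect_le continuous_intros)
      finally have X: "?X \<delta> \<in> sets lebesgue" .
      \<comment> \<open>A deviation of at least \<open>\<epsilon>\<close> forces
        \<open>f x < p\<close> or \<open>f x > q\<close>.\<close>
      have "?X \<delta> \<subseteq> ?P \<delta> \<union> ?Q \<delta>" using p q by (auto simp: dist_real_def)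
      then have "measure lebesgue (?X \<delta>) \<le> measure lebesgue (?P \<delta> \<union> ?Q \<delta>)"
        using X lm by (intro measure_mono_fmeasurable fmeasurable.Un)
      also have "\<dots> \<le> measure lebesgue (?P \<delta>) + measure lebesgue (?Q \<delta>)"
        using lm by (intro measure_Un_le) auto
      finally show ?thesis .
    qed
    then have "\<forall>\<^sub>F \<delta> in at_right 0. measure lebesgue (?X \<delta>) / \<delta>
        \<le> measure lebesgue (?P \<delta>) / \<delta> + measure lebesgue (?Q \<delta>) / \<delta>"
      by (intro eventually_at_rightI[of 0 1])
        (simp_all only: add_divide_distrib[symmetric] divide_right_mono less_imp_le
          greaterThanLessThan_iff zero_less_one)
    moreover have "\<forall>\<^sub>F \<delta> in at_right 0. 0 \<le> measure lebesgue (?X \<delta>) / \<delta>"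
      unfolding eventually_at_right_field by (blast intro: divide_nonneg_pos measure_nonneg zero_less_one)
    ultimately show "((\<lambda>\<delta>. measure lebesgue (?X \<delta>) / \<delta>) \<longlongrightarrow> 0) (at_right 0)"
      using tendsto_sandwich[OF _ _ tendsto_const] by (simp only: add_0_right)
  qed
  then show ?thesis by (intro negligible_subset[OF neg]) blast
qed

section \<open>Variation over arbitrary sets of points\<close>

lemma variation_over_mono_set: "S \<subseteq> T \<Longrightarrow> variation_over S f \<le> variation_over T f"
  unfolding variation_over_def by (rule SUP_subset_mono) auto

lemma variation_over_cong: "(\<And>x. x \<in> S \<Longrightarrow> f x = g x) \<Longrightarrow> variation_over S f = variation_over S g"
  unfolding variation_over_def by (rule SUP_cong) (auto intro!: sum.cong simp: image_subset_iff)

lemma strict_mono_on_subsequence_sum: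
  fixes f x :: "_ \<Rightarrow> real"
  assumes "mono_on {..m} x"
  shows "\<exists>m' y. strict_mono_on {..m'} y \<and> y ` {..m'} \<subseteq> x ` {..m} \<and> y m' = x m \<and>
     (\<Sum>j<m'. \<bar>f (y (Suc j)) - f (y j)\<bar>) = (\<Sum>j<m. \<bar>f (x (Suc j)) - f (x j)\<bar>)"
  using assms
proof (induction m)
  case 0
  then show ?case by (intro exI[of _ 0] exI[of _ x]) (auto simp: strict_mono_on_def)
next
  case (Suc m)
  then have "mono_on {..m} x" by (auto simp: mono_on_def)
  then obtain m' y where y: "strict_mono_on {..m'} y" "y ` {..m'} \<subseteq> x ` {..m}" "y m' = x m"
     "(\<Sum>j<m'. \<bar>f (y (Suc j)) - f (y j)\<bar>) = (\<Sum>j<m. \<bar>f (x (Suc j)) - f (x j)\<bar>)"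
    using Suc.IH by blast
  show ?case
  proof (cases "x (Suc m) = x m")
    case True
    then show ?thesis using y by (intro exI[of _ m'] exI[of _ y]) auto
  next
    case False
    then have less: "x m < x (Suc m)"
      using Suc.prems by (auto simp: mono_on_def less_le)
    let ?y = "y(Suc m' := x (Suc m))"
    have "y i \<le> x m" if "i \<le> m'" for i
      using y(1,3) that by (metis atMost_iff le_refl strict_mono_on_leD)
    then have "strict_mono_on {..Suc m'} ?y"
      using y(1) less by (auto simp: strict_mono_on_def le_Suc_eq intro: le_less_trans)
    moreover have "?y ` {..Suc m'} \<subseteq> x ` {..Suc m}" 
      using y(2) atMost_Suc by (auto simp: subset_iff)
    moreover have "(\<Sum>j<m'. \<bar>f (?y (Suc j)) - f (?y j)\<bar>) = (\<Sum>j<m'. \<bar>f (y (Suc j)) - f (y j)\<bar>)"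
      by (rule sum.cong) auto
    moreover have "?y m' = x m" "?y (Suc m') = x (Suc m)" using y(3) by auto
    ultimately show ?thesis
      using y(4) by (intro exI[of _ "Suc m'"] exI[of _ ?y]) (simp del: fun_upd_apply)
  qed
qed

text \<open>Admitting weakly increasing points spares later constructions a case distinction when
  points coincide.\<close>

lemma variation_over_upper:
  fixes x :: "nat \<Rightarrow> real"
  assumes "mono_on {..m} x" and "x ` {..m} \<subseteq> S"
  shows "ereal (\<Sum>j<m. \<bar>f (x (Suc j)) - f (x j)\<bar>) \<le> variation_over S f"
proof -
  obtain m' y where y: "strict_mono_on {..m'} y" "y ` {..m'} \<subseteq> x ` {..m}"
     "(\<Sum>j<m'. \<bar>f (y (Suc j)) - f (y j)\<bar>) = (\<Sum>j<m. \<bar>f (x (Suc j)) - f (x j)\<bar>)"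
    using strict_mono_on_subsequence_sum[OF assms(1), of f] by blast
  then have "(m', y) \<in> {(m, x). strict_mono_on {..m} x \<and> x ` {..m} \<subseteq> S}"
    using assms(2) by auto
  from SUP_upper[OF this, of "\<lambda>(m, x). ereal (\<Sum>j<m. \<bar>f (x (Suc j)) - f (x j)\<bar>)"] y(3)
  show ?thesis unfolding variation_over_def by simp
qed

lemma variation_over_least:
  assumes "\<And>m x. \<lbrakk>strict_mono_on {..m} x; x ` {..m} \<subseteq> S\<rbrakk>
      \<Longrightarrow> ereal (\<Sum>j<m. \<bar>f (x (Suc j)) - f (x j)\<bar>) \<le> c"
  shows "variation_over S f \<le> c"
  unfolding variation_over_def by (rule SUP_least) (use assms in auto)

lemma variation_over_nonneg: "S \<noteq> {} \<Longrightarrow> 0 \<le> variation_over S f"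
  using variation_over_upper[of 0 "\<lambda>_. SOME x. x \<in> S" S f]
  by (simp add: mono_on_def some_in_eq zero_ereal_def)

lemma variation_over_diff:
  assumes "s \<in> S" "t \<in> S" "s \<le> t"
  shows "ereal \<bar>f t - f s\<bar> \<le> variation_over S f"
proof -
  have "mono_on {..1} (\<lambda>i::nat. if i = 0 then s else t)" using assms by (auto simp: mono_on_def)
  moreover have "(\<lambda>i::nat. if i = 0 then s else t) ` {..1} \<subseteq> S" using assms by auto
  ultimately show ?thesis using variation_over_upper[of 1 "\<lambda>i. if i = 0 then s else t" S f] by simp
qed

lemma variation_over_bounded_oscillation:
  assumes V: "variation_over S f \<le> ereal V" and "s \<in> S" "t \<in> S"
  shows "\<bar>f t - f s\<bar> \<le> V"
proof -
  have "ereal \<bar>f t - f s\<bar> \<le> variation_over S f"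
    using variation_over_diff[of s S t f] variation_over_diff[of t S s f] assms
    by (cases "s \<le> t") (auto simp: abs_minus_commute)
  with V show ?thesis using order_trans ereal_less_eq(3) by blast
qed

text \<open>Append \<open>s\<close> and \<open>t\<close> to any partition of \<open>{a..s}\<close>.
  Thus increments of the variation function dominate those of \<open>f\<close>, the estimate on
  which the selection argument rests.\<close>

lemma variation_over_extend:
  assumes "a \<le> s" "s \<le> t"
  shows "variation_over {a..s} f + ereal \<bar>f t - f s\<bar> \<le> variation_over {a..t} f"
proof -
  have "variation_over {a..s} f \<le> variation_over {a..t} f - ereal \<bar>f t - f s\<bar>"
  proof (rule variation_over_least)
    fix m and x :: "nat \<Rightarrow> real" assume x: "strict_mono_on {..m} x" "x ` {..m} \<subseteq> {a..s}"
    let ?y = "\<lambda>i. if i \<le> m then x i else if i = Suc m then s else t"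
    have "mono_on {..m} x" by (rule strict_mono_on_imp_mono_on[OF x(1)])
    then have "mono_on {..Suc (Suc m)} ?y"
      using x(2) assms by (force simp: mono_on_def image_subset_iff)
    moreover have "?y ` {..Suc (Suc m)} \<subseteq> {a..t}"
      using x(2) assms by (force simp: image_subset_iff)
    ultimately have "ereal (\<Sum>j<Suc (Suc m). \<bar>f (?y (Suc j)) - f (?y j)\<bar>) \<le> variation_over {a..t} f"
      by (rule variation_over_upper)
    moreover have "(\<Sum>j<m. \<bar>f (?y (Suc j)) - f (?y j)\<bar>) = (\<Sum>j<m. \<bar>f (x (Suc j)) - f (x j)\<bar>)"
      by (rule sum.cong) auto
    \<comment> \<open>The term joining \<open>x m\<close> to \<open>s\<close> is nonnegative and is
      discarded.\<close>
    ultimately have "ereal ((\<Sum>j<m. \<bar>f (x (Suc j)) - f (x j)\<bar>) + \<bar>f t - f s\<bar>) \<le> variation_over {a..t} f"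
      by (intro order_trans[OF _ \<open>_ \<le> variation_over {a..t} f\<close>]) auto
    then show "ereal (\<Sum>j<m. \<bar>f (x (Suc j)) - f (x j)\<bar>) \<le> variation_over {a..t} f - ereal \<bar>f t - f s\<bar>"
      by (simp add: ereal_le_minus)
  qed
  then show ?thesis by (simp add: ereal_le_minus)
qed

section \<open>Variation under graph closure and pointwise limits\<close>

text \<open>The gap allows every point to be moved by less than \<open>\<eta>\<close> without
  disturbing the order.\<close>

lemma strict_mono_on_gap:
  fixes x :: "nat \<Rightarrow> real"
  assumes "strict_mono_on {..m} x"
  obtains \<eta> where "\<eta> > 0" "\<And>j. j < m \<Longrightarrow> x j + 2 * \<eta> \<le> x (Suc j)"
proof -
  \<comment> \<open>Inserting \<open>1\<close> keeps the set nonempty when \<open>m = 0\<close>;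
    halving leaves room to move both ends of a gap.\<close>
  let ?G = "insert 1 ((\<lambda>j. (x (Suc j) - x j) / 2) ` {..<m})"
  have "Min ?G > 0" using assms by (auto simp: strict_mono_on_def)
  moreover have "x j + 2 * Min ?G \<le> x (Suc j)" if "j < m" for j
  proof -
    have "Min ?G \<le> (x (Suc j) - x j) / 2" using that by (intro Min_le) auto
    then show ?thesis by simp
  qed
  ultimately show thesis by (rule that)
qed

text \<open>The hypothesis places the graph of \<open>g\<close> over \<open>S\<close> in the closure
  of the graph of \<open>f\<close> over \<open>A\<close>. Moving each partition point to a nearby
  point of \<open>A\<close> preserves the order and changes the sum by arbitrarily little.\<close>

lemma variation_over_le_graph_closure:
  assumes cl: "\<And>t \<eta>. \<lbrakk>t \<in> S; \<eta> > 0\<rbrakk> \<Longrightarrow> \<exists>y\<in>A. \<bar>y - t\<bar> < \<eta> \<and> \<bar>f y - g t\<bar> < \<eta>"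
  shows "variation_over S g \<le> variation_over A f"
proof (rule variation_over_least)
  fix m and x :: "nat \<Rightarrow> real" assume x: "strict_mono_on {..m} x" "x ` {..m} \<subseteq> S"
  obtain \<eta> where \<eta>: "\<eta> > 0" "\<And>j. j < m \<Longrightarrow> x j + 2 * \<eta> \<le> x (Suc j)"
    using strict_mono_on_gap[OF x(1)] by blast
  show "ereal (\<Sum>j<m. \<bar>g (x (Suc j)) - g (x j)\<bar>) \<le> variation_over A f"
  proof (rule ereal_le_epsilon2)
    fix e :: real assume e: "0 < e"
    \<comment> \<open>The bound by \<open>\<eta>\<close> preserves the order; the other one keeps
      the total error, at most \<open>2 * d\<close> for each of the \<open>m\<close> terms, below
      \<open>e\<close>. \<open>Suc m\<close> avoids division by zero.\<close>
    define d where "d = min \<eta> (e / (2 * real (Suc m)))"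
    have d: "d > 0" "d \<le> \<eta>" "d \<le> e / (2 * real (Suc m))" using \<eta> e by (auto simp: d_def)
    have "\<exists>y. \<forall>j\<le>m. y j \<in> A \<and> \<bar>y j - x j\<bar> < d \<and> \<bar>f (y j) - g (x j)\<bar> < d"
      using cl[OF _ d(1)] x(2) by (intro choice) (auto simp: image_subset_iff)
    then obtain y where y: "\<And>j. j \<le> m \<Longrightarrow> y j \<in> A \<and> \<bar>y j - x j\<bar> < d \<and> \<bar>f (y j) - g (x j)\<bar> < d"
      by blast
    have step: "y j \<le> y (Suc j)" if "j < m" for j
      using y[of j] y[of "Suc j"] \<eta>(2)[of j] that d by (auto simp: abs_if split: if_splits)
    have "mono_on {..m} y"
    proof (rule mono_onI)
      fix r s assume "r \<in> {..m}" "s \<in> {..m}" "r \<le> s"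
      from this(3,2) show "y r \<le> y s"
        by (induction s rule: dec_induct) (auto intro: order_trans step simp: Suc_le_eq)
    qed
    then have *: "ereal (\<Sum>j<m. \<bar>f (y (Suc j)) - f (y j)\<bar>) \<le> variation_over A f"
      using y by (intro variation_over_upper) auto
    have "(\<Sum>j<m. \<bar>g (x (Suc j)) - g (x j)\<bar>) \<le> (\<Sum>j<m. \<bar>f (y (Suc j)) - f (y j)\<bar> + 2 * d)"
    proof (rule sum_mono)
      fix j assume "j \<in> {..<m}"
      then show "\<bar>g (x (Suc j)) - g (x j)\<bar> \<le> \<bar>f (y (Suc j)) - f (y j)\<bar> + 2 * d"
        using y[of j] y[of "Suc j"] by auto
    qed
    also have "\<dots> = (\<Sum>j<m. \<bar>f (y (Suc j)) - f (y j)\<bar>) + real m * (2 * d)"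
      by (simp add: sum.distrib)
    also have "real m * (2 * d) \<le> real (Suc m) * (2 * (e / (2 * real (Suc m))))"
      using d by (intro mult_mono) auto
    also have "\<dots> = e" by (simp add: field_simps)
    finally have "ereal (\<Sum>j<m. \<bar>g (x (Suc j)) - g (x j)\<bar>)
        \<le> ereal (\<Sum>j<m. \<bar>f (y (Suc j)) - f (y j)\<bar>) + ereal e" by simp
    also have "\<dots> \<le> variation_over A f + ereal e" by (rule add_right_mono[OF *])
    finally show "ereal (\<Sum>j<m. \<bar>g (x (Suc j)) - g (x j)\<bar>) \<le> variation_over A f + ereal e" .
  qed
qed

text \<open>Lower semicontinuity: for a fixed partition the finite sum passes to the pointwise
  limit, and the bound survives.\<close>

lemma variation_over_limit_le:
  assumes lim: "\<And>x. x \<in> S \<Longrightarrow> (\<lambda>k. v k x) \<longlonglongrightarrow> w x"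
    and V: "\<And>k. variation_over S (v k) \<le> ereal V"
  shows "variation_over S w \<le> ereal V"
proof (rule variation_over_least)
  fix m and x :: "nat \<Rightarrow> real" assume x: "strict_mono_on {..m} x" "x ` {..m} \<subseteq> S"
  have "(\<lambda>k. \<Sum>j<m. \<bar>v k (x (Suc j)) - v k (x j)\<bar>) \<longlonglongrightarrow> (\<Sum>j<m. \<bar>w (x (Suc j)) - w (x j)\<bar>)"
    using x(2) by (intro tendsto_intros lim) (auto simp: image_subset_iff)
  moreover have "(\<Sum>j<m. \<bar>v k (x (Suc j)) - v k (x j)\<bar>) \<le> V" for k
    using order_trans[OF variation_over_upper[OF strict_mono_on_imp_mono_on[OF x(1)] x(2)] V[of k]] by simp
  ultimately show "ereal (\<Sum>j<m. \<bar>w (x (Suc j)) - w (x j)\<bar>) \<le> ereal V"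
    by (simp add: LIMSEQ_le_const2)
qed

section \<open>Helly's selection theorem\<close>

lemma Helly_selection_variation:
  fixes v :: "nat \<Rightarrow> real \<Rightarrow> real"
  assumes ab: "a \<le> b"
    and V: "\<And>n. variation_over {a..b} (v n) \<le> ereal V"
    and B: "\<And>n x. x \<in> {a..b} \<Longrightarrow> \<bar>v n x\<bar> \<le> B"
  obtains r :: "nat \<Rightarrow> nat" and w where "strict_mono r"
    "\<And>x. x \<in> {a..b} \<Longrightarrow> (\<lambda>k. v (r k) x) \<longlonglongrightarrow> w x"
proof -
  define T where "T n t = real_of_ereal (variation_over {a..t} (v n))" for n t
  have Tv: "variation_over {a..t} (v n) = ereal (T n t)" and T0: "0 \<le> T n t" and TV: "T n t \<le> V"
    if "t \<in> {a..b}" for n t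
  proof -
    have "0 \<le> variation_over {a..t} (v n)" "variation_over {a..t} (v n) \<le> ereal V"
      using that variation_over_nonneg[of "{a..t}" "v n"] variation_over_mono_set[of "{a..t}" "{a..b}" "v n"] V[of n]
      by auto
    then show "variation_over {a..t} (v n) = ereal (T n t)" "0 \<le> T n t" "T n t \<le> V"
      unfolding T_def by (cases "variation_over {a..t} (v n)"; simp)+
  qed
  \<comment> \<open>In particular each \<open>T n\<close> is monotone on
    \<open>{a..b}\<close>.\<close>
  have osc: "\<bar>v n t - v n s\<bar> \<le> T n t - T n s" if "a \<le> s" "s \<le> t" "t \<le> b" for n s t
    using variation_over_extend[of a s t "v n"] that by (simp add: Tv)
  \<comment> \<open>Including \<open>b\<close> makes \<open>{d \<in> D. t \<le> d}\<close> nonempty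
    for every \<open>t\<close> in \<open>{a..b}\<close>; with both endpoints in \<open>D\<close>,
    the remaining points are interior and have rationals of the interval on either side.\<close>
  define D where "D = {a, b} \<union> ({a..b} \<inter> \<rat>)"
  have D: "countable D" "D \<subseteq> {a..b}" "b \<in> D" using ab by (auto simp: D_def countable_rat)
  obtain r1 :: "nat \<Rightarrow> nat" where r1: "strict_mono r1" "\<And>x. x \<in> D \<Longrightarrow> \<exists>l. (\<lambda>n. T (r1 n) x) \<longlonglongrightarrow> l"
    by (rule function_convergent_subsequence[of D T V]) (use D T0 TV in force)+
  then obtain L where L: "\<And>d. d \<in> D \<Longrightarrow> (\<lambda>n. T (r1 n) d) \<longlonglongrightarrow> L d" by metis
  have L_mono: "L d \<le> L d'" if "d \<in> D" "d' \<in> D" "d \<le> d'" for d d'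
  proof (rule LIMSEQ_le[OF L L])
    show "\<exists>N. \<forall>n\<ge>N. T (r1 n) d \<le> T (r1 n) d'"
    proof (intro exI allI impI)
      fix n
      have "d \<in> {a..b}" "d' \<in> {a..b}" using that D(2) by blast+
      then have "\<bar>v (r1 n) d' - v (r1 n) d\<bar> \<le> T (r1 n) d' - T (r1 n) d"
        using \<open>d \<le> d'\<close> by (intro osc) auto
      then show "T (r1 n) d \<le> T (r1 n) d'" by linarith
    qed
  qed (use that in auto)
  have L0: "0 \<le> L d" if "d \<in> D" for d
    using that D T0 by (intro LIMSEQ_le_const[OF L[OF that]]) auto
  \<comment> \<open>the monotone extension of \<open>L\<close> from \<open>D\<close> to \<open>{a..b}\<close>\<close>
  define G where "G t = (INF d\<in>{d \<in> D. t \<le> d}. L d)" for t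
  have bdd: "bdd_below (L ` {d \<in> D. t \<le> d})" for t using L0 by (intro bdd_belowI[of _ 0]) auto
  have GL: "G d = L d" if "d \<in> D" for d
    unfolding G_def by (rule cInf_eq_minimum) (use that L_mono in auto)
  have "mono_on {a..b} G"
    unfolding G_def using D by (intro mono_onI cINF_superset_mono bdd) auto
  then have "countable {t \<in> {a..b}. \<not> continuous (at t within {a..b}) G}"
    by (rule mono_on_ctble_discont)
  \<comment> \<open>The oscillation estimate below works only where \<open>G\<close> is continuous;
    at the countably many other points, and on \<open>D\<close>, convergence is forced by a diagonal
    extraction.\<close>
  then have "countable (D \<union> {t \<in> {a..b}. \<not> continuous (at t within {a..b}) G})" (is "countable ?C")
    using D by auto
  then obtain r2 :: "nat \<Rightarrow> nat" where r2: "strict_mono r2" "\<And>x. x \<in> ?C \<Longrightarrow> \<exists>l. (\<lambda>n. v (r1 (r2 n)) x) \<longlonglongrightarrow> l"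
    by (rule function_convergent_subsequence[of ?C "\<lambda>n. v (r1 n)" B]) (use D B in auto)
  let ?r = "\<lambda>n. r1 (r2 n)"
  have "\<exists>l. (\<lambda>n. v (?r n) t) \<longlonglongrightarrow> l" if t: "t \<in> {a..b}" for t
  proof (cases "t \<in> ?C")
    case True
    then show ?thesis by (rule r2)
  next
    case False
    then have "t \<noteq> a" "t \<noteq> b" and cont: "continuous (at t within {a..b}) G" using t by (auto simp: D_def)
    then have ab': "a < t" "t < b" using t by auto
    have "Cauchy (\<lambda>n. v (?r n) t)"
    proof (rule metric_CauchyI)
      fix e :: real assume e: "e > 0"
      \<comment> \<open>The tolerance \<open>e / 8\<close> on each side of \<open>t\<close> makes
        the increment of \<open>G\<close> between two such neighbours less than
        \<open>e / 4\<close>.\<close>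
      obtain \<delta> where \<delta>: "\<delta> > 0" "\<And>s. \<lbrakk>s \<in> {a..b}; \<bar>s - t\<bar> < \<delta>\<rbrakk> \<Longrightarrow> \<bar>G s - G t\<bar> < e / 8"
        using cont e unfolding continuous_within_eps_delta dist_real_def
        by (metis zero_less_divide_iff zero_less_numeral)
      obtain d where d: "d \<in> \<rat>" "max a (t - \<delta>) < d" "d < t"
        using Rats_dense_in_real[of "max a (t - \<delta>)" t] ab' \<delta> by auto
      obtain d' where d': "d' \<in> \<rat>" "t < d'" "d' < min b (t + \<delta>)"
        using Rats_dense_in_real[of t "min b (t + \<delta>)"] ab' \<delta> by auto
      have dD: "d \<in> D" "d' \<in> D" using d d' ab' by (auto simp: D_def)
      have "L d' - L d < e / 4"
        using \<delta>(2)[of d] \<delta>(2)[of d'] d d' ab' e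
        by (auto simp: GL[OF dD(1)] GL[OF dD(2)] abs_if split: if_splits)
      moreover have "(\<lambda>n. T (?r n) d' - T (?r n) d) \<longlonglongrightarrow> L d' - L d"
        using LIMSEQ_subseq_LIMSEQ[OF tendsto_diff[OF L[OF dD(2)] L[OF dD(1)]] r2(1)] by (simp add: o_def)
      ultimately have ev1: "\<forall>\<^sub>F n in sequentially. T (?r n) d' - T (?r n) d < e / 4"
        by (rule order_tendstoD(2)[rotated])
      \<comment> \<open>\<open>l\<close> is the limit at the neighbour \<open>d\<close> and depends
        on \<open>e\<close>; it serves only as a common reference value for the late terms at
        \<open>t\<close>.\<close>
      obtain l where "(\<lambda>n. v (?r n) d) \<longlonglongrightarrow> l" using r2(2) dD by blast
      then have "\<forall>\<^sub>F n in sequentially. \<bar>v (?r n) d - l\<bar> < e / 4"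
        using tendstoD[of _ l sequentially "e / 4"] e by (simp add: dist_real_def)
      with ev1 have "\<forall>\<^sub>F n in sequentially. \<bar>v (?r n) t - l\<bar> < e / 2"
      proof eventually_elim
        case (elim n)
        \<comment> \<open>By monotonicity the increment from \<open>d\<close> to \<open>t\<close> is
          at most that from \<open>d\<close> to \<open>d'\<close>, so only the convergence of
          \<open>T\<close> on \<open>D\<close> enters.\<close>
        have "\<bar>v (?r n) t - v (?r n) d\<bar> \<le> T (?r n) t - T (?r n) d" "T (?r n) t \<le> T (?r n) d'"
          using osc[of d t "?r n"] osc[of t d' "?r n"] d d' ab' by auto
        then show ?case using elim by (auto simp: abs_if split: if_splits)
      qed
      then obtain N where N: "\<And>n. n \<ge> N \<Longrightarrow> \<bar>v (?r n) t - l\<bar> < e / 2"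
        by (auto simp: eventually_sequentially)
      have "dist (v (?r m) t) (v (?r n) t) < e" if "m \<ge> N" "n \<ge> N" for m n
        using N[OF that(1)] N[OF that(2)] by (auto simp: dist_real_def abs_if split: if_splits)
      then show "\<exists>N. \<forall>m\<ge>N. \<forall>n\<ge>N. dist (v (?r m) t) (v (?r n) t) < e" by blast
    qed
    then show ?thesis using convergent_eq_Cauchy by blast
  qed
  then obtain w where "\<And>t. t \<in> {a..b} \<Longrightarrow> (\<lambda>n. v (?r n) t) \<longlonglongrightarrow> w t" by metis
  moreover have "strict_mono ?r" using r1(1) r2(1) by (simp add: strict_mono_def)
  ultimately show thesis by (rule that[rotated])
qed

section \<open>Existence of good representatives\<close>

text \<open>A null set contains no nondegenerate interval, and since \<open>a < b\<close> every
  neighbourhood of \<open>t\<close>, even at an endpoint, meets \<open>{a..b}\<close> in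
  one.\<close>

lemma AE_lebesgue_on_interval_dense:
  fixes a b t \<eta> :: real
  assumes ae: "AE x in lebesgue_on {a..b}. P x"
    and "a < b" "t \<in> {a..b}" "\<eta> > 0"
  shows "\<exists>y\<in>{a..b}. P y \<and> \<bar>y - t\<bar> < \<eta>"
proof (rule ccontr)
  assume contr: "\<not> (\<exists>y\<in>{a..b}. P y \<and> \<bar>y - t\<bar> < \<eta>)"
  let ?c = "max a (t - \<eta>)" and ?d = "min b (t + \<eta>)"
  have "AE x in lebesgue. x \<in> {a..b} \<longrightarrow> P x"
    using ae by (subst (asm) AE_restrict_space_iff) auto
  then have "AE x in lebesgue. x \<notin> box ?c ?d"
    by (rule AE_mp) (use contr in \<open>auto simp: box_real intro!: AE_I2\<close>)
  then have "negligible (box ?c ?d)"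
    by (simp add: negligible_iff_null_sets AE_iff_null_sets)
  then have "box ?c ?d = {}" by (simp only: negligible_interval)
  then show False using assms by (auto simp: box_real)
qed

text \<open>By Bolzano-Weierstrass, \<open>f\<close> has a cluster value along points of
  \<open>A\<close> tending to \<open>t\<close>; any such value will do outside \<open>A\<close>,
  while on \<open>A\<close> the value of \<open>f\<close> is kept.\<close>

lemma graph_closure_extension:
  fixes f :: "real \<Rightarrow> real"
  assumes dense: "\<And>t \<eta>. \<lbrakk>t \<in> S; \<eta> > 0\<rbrakk> \<Longrightarrow> \<exists>y\<in>A. \<bar>y - t\<bar> < \<eta>"
    and bdd: "\<And>y. y \<in> A \<Longrightarrow> \<bar>f y\<bar> \<le> B"
  shows "\<exists>g. (\<forall>t\<in>A. g t = f t) \<and>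
    (\<forall>t\<in>S. \<forall>\<eta>>0. \<exists>y\<in>A. \<bar>y - t\<bar> < \<eta> \<and> \<bar>f y - g t\<bar> < \<eta>)"
proof -
  have "\<exists>l. \<forall>\<eta>>0. \<exists>y\<in>A. \<bar>y - t\<bar> < \<eta> \<and> \<bar>f y - l\<bar> < \<eta>" if t: "t \<in> S" for t
  proof -
    have "\<exists>y. \<forall>n. y n \<in> A \<and> \<bar>y n - t\<bar> < inverse (real (Suc n))"
      by (intro choice allI) (use dense[OF t, of "inverse (real (Suc _))"] in auto)
    then obtain y where y: "\<And>n. y n \<in> A" "\<And>n. \<bar>y n - t\<bar> < inverse (real (Suc n))" by blast
    have "bounded (range (\<lambda>n. f (y n)))"
      using bdd[OF y(1)] by (auto simp: bounded_iff)
    then obtain l and r :: "nat \<Rightarrow> nat" where r: "strict_mono r" "((\<lambda>n. f (y n)) \<circ> r) \<longlonglongrightarrow> l"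
      using bounded_imp_convergent_subsequence by blast
    have "\<exists>y\<in>A. \<bar>y - t\<bar> < \<eta> \<and> \<bar>f y - l\<bar> < \<eta>" if \<eta>: "\<eta> > 0" for \<eta>
    proof -
      have "(\<lambda>n. inverse (real (Suc n))) \<longlonglongrightarrow> 0" by (rule LIMSEQ_inverse_real_of_nat)
      then have "\<forall>\<^sub>F n in sequentially. inverse (real (Suc (r n))) < \<eta>"
        using order_tendstoD(2)[OF LIMSEQ_subseq_LIMSEQ[OF _ r(1)] \<eta>] by (simp add: o_def)
      moreover have "\<forall>\<^sub>F n in sequentially. \<bar>f (y (r n)) - l\<bar> < \<eta>"
        using tendstoD[OF r(2) \<eta>] by (simp add: dist_real_def)
      ultimately have "\<forall>\<^sub>F n in sequentially. \<bar>y (r n) - t\<bar> < \<eta> \<and> \<bar>f (y (r n)) - l\<bar> < \<eta>"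
        by eventually_elim (use y(2) less_trans in blast)
      then show ?thesis using y(1) by (auto dest!: eventually_happens)
    qed
    then show ?thesis by blast
  qed
  then obtain h where h: "\<And>t \<eta>. \<lbrakk>t \<in> S; \<eta> > 0\<rbrakk> \<Longrightarrow> \<exists>y\<in>A. \<bar>y - t\<bar> < \<eta> \<and> \<bar>f y - h t\<bar> < \<eta>"
    by metis
  have "\<exists>y\<in>A. \<bar>y - t\<bar> < \<eta> \<and> \<bar>f y - (if t \<in> A then f t else h t)\<bar> < \<eta>"
    if "t \<in> S" "\<eta> > 0" for t \<eta>
    using that h[OF that] by (cases "t \<in> A") (auto intro: bexI[of _ t])
  then show ?thesis by (intro exI[of _ "\<lambda>t. if t \<in> A then f t else h t"]) auto
qed

text \<open>The points of approximate continuity form a dense set \<open>A\<close> of full measure,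
  on which finite variation makes \<open>f\<close> bounded. The extension by cluster values agrees
  with \<open>f\<close> on \<open>A\<close>, so its variation is at least \<open>TV a b f\<close>;
  its graph lies in the closure of that of \<open>f\<close> over \<open>A\<close>, so it is at most
  \<open>TV a b f\<close>.\<close>

lemma good_representative_exists:
  assumes ab: "a < b" and f: "bounded_variation a b f"
  shows "\<exists>g. good_representative a b f g"
proof -
  define A where "A = {t \<in> {a..b}. approx_continuous_at a b f t}"
  have "negligible {t \<in> {a..b}. \<not> approx_continuous_at a b f t}"
    using f by (intro negligible_not_approx_continuous_at) (auto simp: bounded_variation_def)
  then have "AE x in lebesgue_on {a..b}. approx_continuous_at a b f x"
    by (subst AE_restrict_space_iff)
       (auto simp: negligible_iff_null_sets intro: AE_I')
  then have aeA: "AE x in lebesgue_on {a..b}. x \<in> A"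
    unfolding A_def by (rule AE_mp) (auto intro!: AE_I2)
  have dense: "\<exists>y\<in>A. \<bar>y - t\<bar> < \<eta>" if "t \<in> {a..b}" "\<eta> > 0" for t \<eta>
    using AE_lebesgue_on_interval_dense[OF aeA ab that] by blast
  then obtain y0 where y0: "y0 \<in> A" using ab by (meson atLeastAtMost_iff less_imp_le order_refl zero_less_one)
  have "0 \<le> variation_over A f" using y0 by (intro variation_over_nonneg) auto
  moreover have "variation_over A f < \<infinity>"
    using f by (simp add: bounded_variation_def TV_def A_def)
  ultimately obtain V where V: "variation_over A f = ereal V"
    by (cases "variation_over A f") auto
  have "\<bar>f y\<bar> \<le> \<bar>f y0\<bar> + V" if "y \<in> A" for y
    using variation_over_bounded_oscillation[of A f V y0 y] V y0 that by auto
  then have "\<exists>g. (\<forall>t\<in>A. g t = f t) \<and>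
      (\<forall>t\<in>{a..b}. \<forall>\<eta>>0. \<exists>y\<in>A. \<bar>y - t\<bar> < \<eta> \<and> \<bar>f y - g t\<bar> < \<eta>)"
    by (intro graph_closure_extension dense)
  then obtain g where g: "\<forall>t\<in>A. g t = f t"
    "\<forall>t\<in>{a..b}. \<forall>\<eta>>0. \<exists>y\<in>A. \<bar>y - t\<bar> < \<eta> \<and> \<bar>f y - g t\<bar> < \<eta>"
    by (elim exE conjE)
  have "variation_over {a..b} g = variation_over A f"
  proof (rule antisym)
    show "variation_over {a..b} g \<le> variation_over A f"
      by (rule variation_over_le_graph_closure) (use g(2) in blast)
    have "variation_over A f = variation_over A g" using g(1) by (intro variation_over_cong) auto
    also have "\<dots> \<le> variation_over {a..b} g" by (intro variation_over_mono_set) (auto simp: A_def)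
    finally show "variation_over A f \<le> variation_over {a..b} g" .
  qed
  moreover have "AE x in lebesgue_on {a..b}. g x = f x"
    using aeA by eventually_elim (use g(1) in blast)
  ultimately show ?thesis
    unfolding good_representative_def TV_def A_def by blast
qed

section \<open>Measurability of representatives and the compactness theorem\<close>

text \<open>This is completeness of Lebesgue measure, applied to the extensions by zero outside
  \<open>S\<close>.\<close>

lemma borel_measurable_lebesgue_on_AE:
  fixes f g :: "real \<Rightarrow> real"
  assumes f: "f \<in> borel_measurable (lebesgue_on S)" and S: "S \<in> sets lebesgue"
    and ae: "AE x in lebesgue_on S. f x = g x"
  shows "g \<in> borel_measurable (lebesgue_on S)"
proof -
  have "(\<lambda>x. if x \<in> S then f x else 0) \<in> borel_measurable lebesgue"
    using f S by (simp add: borel_measurable_if)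
  moreover have "AE x in lebesgue. (if x \<in> S then f x else 0) = (if x \<in> S then g x else 0)"
    using ae S by (subst (asm) AE_restrict_space_iff) (auto elim!: eventually_mono)
  ultimately have "(\<lambda>x. if x \<in> S then g x else 0) \<in> borel_measurable lebesgue"
    by (rule borel_measurable_AE)
  then show ?thesis using S by (simp add: borel_measurable_if)
qed

text \<open>The existence of representatives is stated separately so that the claim about every
  choice of them is not vacuous. Pointwise convergence concerns the representatives; convergence in
  norm depends only on almost-everywhere classes and is stated for \<open>u\<close> itself.\<close>

theorem theorem12:
  fixes a b M :: real and u :: "nat \<Rightarrow> real \<Rightarrow> real"
  assumes "a < b"
    and "\<And>n. bounded_variation a b (u n)"
    and "\<And>n. TV a b (u n) \<le> ereal M"
    and "\<And>n. Linf_norm a b (u n) \<le> ereal M"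
  shows "(\<exists>v. \<forall>n. good_representative a b (u n) (v n)) \<and>
    (\<forall>v. (\<forall>n. good_representative a b (u n) (v n)) \<longrightarrow>
      (\<exists>(r :: nat \<Rightarrow> nat) w. strict_mono r \<and> bounded_variation a b w \<and>
        (\<forall>x\<in>{a..b}. (\<lambda>k. v (r k) x) \<longlonglongrightarrow> w x) \<and>
        (\<lambda>k. \<integral>x. \<bar>u (r k) x - w x\<bar> \<partial>lebesgue_on {a..b}) \<longlonglongrightarrow> 0))"
proof (intro conjI allI impI)
  show "\<exists>v. \<forall>n. good_representative a b (u n) (v n)"
    by (intro choice allI good_representative_exists assms)
next
  let ?L = "lebesgue_on {a..b}"
  fix v assume v: "\<forall>n. good_representative a b (u n) (v n)"
  have ae: "AE x in ?L. v n x = u n x" for n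
    using v by (auto simp: good_representative_def)
  have var: "variation_over {a..b} (v n) \<le> ereal M" for n
    using v assms(3)[of n] by (simp add: good_representative_def)
  \<comment> \<open>The essential bound gives one point \<open>y\<close> with
    \<open>\<bar>v n y\<bar> \<le> M\<close>; the variation bound adds an oscillation of at most
    \<open>M\<close>.\<close>
  have bound: "\<bar>v n x\<bar> \<le> 2 * M" if x: "x \<in> {a..b}" for n x
  proof -
    have "AE x in ?L. ereal \<bar>u n x\<bar> \<le> Linf_norm a b (u n)"
      unfolding Linf_norm_def by (rule esssup_AE)
    then have "AE x in ?L. \<bar>v n x\<bar> \<le> M"
      using ae[of n]
    proof eventually_elim
      case (elim x)
      have "ereal \<bar>u n x\<bar> \<le> ereal M" using elim(1) assms(4) by (rule order_trans)
      then show ?case using elim(2) by simp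
    qed
    from AE_lebesgue_on_interval_dense[OF this \<open>a < b\<close> x zero_less_one]
    obtain y where y: "y \<in> {a..b}" "\<bar>v n y\<bar> \<le> M" by blast
    have "\<bar>v n x - v n y\<bar> \<le> M"
      using variation_over_bounded_oscillation[OF var y(1) x] .
    with y(2) show ?thesis by linarith
  qed
  obtain r :: "nat \<Rightarrow> nat" and w where r: "strict_mono r"
    and lim: "\<And>x. x \<in> {a..b} \<Longrightarrow> (\<lambda>k. v (r k) x) \<longlonglongrightarrow> w x"
    using Helly_selection_variation[of a b v M "2 * M"] \<open>a < b\<close> var bound by (metis less_imp_le)
  have u_meas: "u n \<in> borel_measurable ?L" for n
    using assms(2)[of n] by (auto simp: bounded_variation_def)
  have v_meas: "v n \<in> borel_measurable ?L" for n
  proof (rule borel_measurable_lebesgue_on_AE[OF u_meas])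
    show "AE x in ?L. u n x = v n x" using ae[of n] by eventually_elim (rule sym)
  qed simp
  have w_meas: "w \<in> borel_measurable ?L"
    by (rule borel_measurable_LIMSEQ_metric[OF v_meas lim]) simp
  have const: "integrable ?L (\<lambda>_. c)" for c :: real
    by (intro finite_measure.integrable_const finite_measure_lebesgue_on) simp
  have w_bound: "\<bar>w x\<bar> \<le> 2 * M" if "x \<in> {a..b}" for x
    by (rule LIMSEQ_le_const2[OF tendsto_rabs[OF lim[OF that]]]) (use bound[OF that] in blast)
  have "integrable ?L w"
    by (rule Bochner_Integration.integrable_bound[OF const[of "2 * M"] w_meas])
       (use w_bound in \<open>force intro!: AE_I2\<close>)
  moreover have "TV a b w < \<infinity>"
  proof -
    \<comment> \<open>\<open>TV\<close> admits only partitions through points of approximate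
      continuity of \<open>w\<close>, hence is dominated by the full variation.\<close>
    have "TV a b w \<le> variation_over {a..b} w"
      unfolding TV_def by (rule variation_over_mono_set) auto
    also have "\<dots> \<le> ereal M" by (rule variation_over_limit_le[OF lim var])
    finally show ?thesis by (auto intro: le_less_trans)
  qed
  moreover have "(\<lambda>k. \<integral>x. \<bar>u (r k) x - w x\<bar> \<partial>?L) \<longlonglongrightarrow> 0"
  proof -
    have "(\<lambda>k. \<integral>x. \<bar>v (r k) x - w x\<bar> \<partial>?L) \<longlonglongrightarrow> (\<integral>x. 0 \<partial>?L)"
    proof (rule integral_dominated_convergence)
      \<comment> \<open>The dominating constant adds the bounds \<open>2 * M\<close> for
        \<open>v (r k)\<close> and for \<open>w\<close>.\<close>
      show "integrable ?L (\<lambda>_. 4 * M)" by (rule const)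
      show "AE x in ?L. (\<lambda>k. \<bar>v (r k) x - w x\<bar>) \<longlonglongrightarrow> 0"
        using lim by (intro AE_I2) (auto intro!: tendsto_rabs_zero simp: LIM_zero_iff)
      show "AE x in ?L. norm \<bar>v (r k) x - w x\<bar> \<le> 4 * M" for k
      proof (intro AE_I2)
        fix x assume "x \<in> space ?L"
        then show "norm \<bar>v (r k) x - w x\<bar> \<le> 4 * M"
          using bound[of x "r k"] w_bound[of x] by auto
      qed
    qed (use v_meas w_meas in measurable)
    moreover have "(\<integral>x. \<bar>v (r k) x - w x\<bar> \<partial>?L) = (\<integral>x. \<bar>u (r k) x - w x\<bar> \<partial>?L)" for k
      by (rule integral_cong_AE) (use v_meas u_meas w_meas ae[of "r k"] in auto)
    ultimately show ?thesis by simp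
  qed
  ultimately show "\<exists>(r :: nat \<Rightarrow> nat) w. strict_mono r \<and> bounded_variation a b w \<and>
        (\<forall>x\<in>{a..b}. (\<lambda>k. v (r k) x) \<longlonglongrightarrow> w x) \<and>
        (\<lambda>k. \<integral>x. \<bar>u (r k) x - w x\<bar> \<partial>?L) \<longlonglongrightarrow> 0"
    using r lim unfolding bounded_variation_def by blast
qed

end
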